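(* Let $E \subset \mathbb{R}$ be compact, let $M > \eta \ge 0$, and let $f: E \to \mathbb{R}$. Suppose that for every $S \subset E$ with $\#S \le 5$ there exists an $\eta$-strongly convex function $F^S \in C^{1,1}_c(\mathbb{R})$ satisfying $F^S|_S = f|_S$ and $\mathrm{Lip}(\nabla F^S) \le M$. Then there exists an $\eta$-strongly convex function $F \in C^{1,1}_c(\mathbb{R})$ satisfying $F|_E = f|_E$ and $\mathrm{Lip}(\nabla F) \le 5M$.
   Context: $C^{1,1}_c(\mathbb{R})$ denotes the set of convex, differentiable functions $F:\mathbb{R}\to\mathbb{R}$ whose derivative $\nabla F = F'$ is (globally) Lipschitz continuous. $\mathrm{Lip}(G) = \sup_{x \ne y} |G(x)-G(y)|/|x-y|$. For $\eta \ge 0$, $F$ is $\eta$-strongly convex if $x \mapsto F(x) - \frac{\eta}{2}|x|^2$ is convex. $\#S$ is the cardinality of $S$. *)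

theory Defs
  imports "HOL-Analysis.Analysis"
begin

definition C11c :: "(real \<Rightarrow> real) set" where
  "C11c = {F. convex_on UNIV F \<and> F differentiable_on UNIV
            \<and> (\<exists>L. L-lipschitz_on UNIV (deriv F))}"

(* Extended-real valued, so that the supremum is meaningful also when the
   difference quotients are unbounded. *)
definition Lip :: "(real \<Rightarrow> real) \<Rightarrow> ereal" where
  "Lip G = (SUP (x, y) \<in> {(x, y). x \<noteq> y}. ereal (\<bar>G x - G y\<bar> / \<bar>x - y\<bar>))"

definition strongly_convex :: "real \<Rightarrow> (real \<Rightarrow> real) \<Rightarrow> bool" where
  "strongly_convex \<eta> F \<longleftrightarrow> convex_on UNIV (\<lambda>x. F x - \<eta> / 2 * \<bar>x\<bar>\<^sup>2)"

lemma Lip_le_iff: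
  assumes "L \<ge> 0"
  shows "Lip G \<le> ereal L \<longleftrightarrow> L-lipschitz_on UNIV G"
proof -
  have "Lip G \<le> ereal L \<longleftrightarrow> (\<forall>x y. x \<noteq> y \<longrightarrow> \<bar>G x - G y\<bar> / \<bar>x - y\<bar> \<le> L)"
    unfolding Lip_def by (auto simp: SUP_le_iff)
  also have "\<dots> \<longleftrightarrow> (\<forall>x y. \<bar>G x - G y\<bar> \<le> L * \<bar>x - y\<bar>)"
  proof -
    have "(x \<noteq> y \<longrightarrow> \<bar>G x - G y\<bar> / \<bar>x - y\<bar> \<le> L) \<longleftrightarrow> \<bar>G x - G y\<bar> \<le> L * \<bar>x - y\<bar>" for x y
      by (cases "x = y") (simp_all add: divide_le_eq)
    then show ?thesis by simp
  qed
  also have "\<dots> \<longleftrightarrow> L-lipschitz_on UNIV G"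
    using assms by (simp add: lipschitz_on_def dist_real_def)
  finally show ?thesis .
qed

end

theory Submission
  imports Defs
begin

text \<open>
  Subtracting \<open>\<eta> / 2 * x\<^sup>2\<close> from every function turns the class of \<open>\<eta>\<close>-strongly convex
  functions with \<open>M\<close>-Lipschitz derivative into that of convex functions with \<open>m\<close>-Lipschitz
  derivative, \<open>m = M - \<eta>\<close>. It is then enough to interpolate with Lipschitz constant
  \<open>7 / 2 * m\<close>, because \<open>7 / 2 * (M - \<eta>) + \<eta> \<le> 5 * M\<close>.

  Let first the set be finite, \<open>x\<^sub>0 < \<dots> < x\<^sub>n\<close>, and let \<open>s\<^sub>i\<close> be the slope of the data on
  \<open>[x\<^sub>i, x\<^sub>i\<^sub>+\<^sub>1]\<close> and \<open>a\<^sub>i = m (x\<^sub>i\<^sub>+\<^sub>1 - x\<^sub>i)\<close>. Only the derivatives \<open>p\<^sub>i\<close> at the points have to be found: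
  once they are fixed, the problem splits into one problem for each interval. With
  \<open>u\<^sub>i = s\<^sub>i - p\<^sub>i\<close> and \<open>v\<^sub>i = p\<^sub>i\<^sub>+\<^sub>1 - s\<^sub>i\<close>, both nonnegative, the interval is solvable with constant
  \<open>L\<close> if and only if \<open>(u\<^sub>i + v\<^sub>i)\<^sup>2 \<le> 2 L (x\<^sub>i\<^sub>+\<^sub>1 - x\<^sub>i) min(u\<^sub>i, v\<^sub>i)\<close>
  (\<open>two_point_interpolation\<close> for sufficiency, and pieces are joined by \<open>taylor_jet_glue\<close>).
  Consecutive intervals are coupled only by \<open>v\<^sub>i\<^sub>-\<^sub>1 + u\<^sub>i = D\<^sub>i\<close>, where \<open>D\<^sub>i = s\<^sub>i - s\<^sub>i\<^sub>-\<^sub>1\<close>.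
  So each jump \<open>D\<^sub>i\<close> has to be divided between its two neighbouring intervals.

  Any solution with constant \<open>m\<close> obeys the upper bounds
  \<open>u\<^sub>i \<le> U\<^sub>i = min(D\<^sub>i, a\<^sub>i / 2, sqrt(2 a\<^sub>i D\<^sub>i\<^sub>+\<^sub>1))\<close> and symmetrically \<open>v\<^sub>i \<le> V\<^sub>i\<close>, where
  at \<open>x\<^sub>0\<close> and \<open>x\<^sub>n\<close> the terms with a jump that does not exist are left out. These bounds have two
  virtues. A solution on the five points \<open>x\<^sub>i\<^sub>-\<^sub>2, \<dots>, x\<^sub>i\<^sub>+\<^sub>2\<close> already forces
  \<open>D\<^sub>i \<le> V\<^sub>i\<^sub>-\<^sub>1 + U\<^sub>i\<close>, and the pair \<open>(U\<^sub>i, V\<^sub>i)\<close> is itself admissible for the interval, up to a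
  constant. Dividing \<open>D\<^sub>i\<close> in the proportion \<open>V\<^sub>i\<^sub>-\<^sub>1 : U\<^sub>i\<close> shrinks each bound by a factor between
  \<open>1 / 2\<close> and \<open>1\<close>, because \<open>V\<^sub>i\<^sub>-\<^sub>1\<close> and \<open>U\<^sub>i\<close> are at most \<open>D\<^sub>i\<close>. Such a bounded distortion keeps the pairs
  admissible with the constant \<open>7 / 2 * m\<close> (\<open>half_caps_compatible\<close>, \<open>sequence_interpolation\<close>).

  For an infinite set, the interpolants of its finite subsets have values and derivatives that
  are bounded at every point, and the defining inequalities are closed under pointwise
  convergence. Tychonoff's theorem then yields a common interpolant
  (\<open>interpolation_by_compactness\<close>).
\<close>

section \<open>Convex functions with Lipschitz derivative\<close>

text \<open>
  With \<open>L > 0\<close>, this says that \<open>F\<close> is convex and differentiable with derivative \<open>g\<close>, and that \<open>g\<close>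
  is Lipschitz with constant \<open>L\<close>. In this form the class is given by inequalities that
  involve two points each, which can be glued by hand and survive pointwise limits.
\<close>
definition taylor_jet :: "real \<Rightarrow> (real \<Rightarrow> real) \<Rightarrow> (real \<Rightarrow> real) \<Rightarrow> bool" where
  "taylor_jet L F g \<longleftrightarrow>
     (\<forall>x y. 0 \<le> F y - F x - g x * (y - x) \<and> F y - F x - g x * (y - x) \<le> L / 2 * (y - x)\<^sup>2)"

lemma taylor_jetD:
  assumes "taylor_jet L F g"
  shows "F x + g x * (y - x) \<le> F y" "F y \<le> F x + g x * (y - x) + L / 2 * (y - x)\<^sup>2"
proof -
  have "0 \<le> F y - F x - g x * (y - x) \<and> F y - F x - g x * (y - x) \<le> L / 2 * (y - x)\<^sup>2"
    using assms unfolding taylor_jet_def by blast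
  then show "F x + g x * (y - x) \<le> F y" "F y \<le> F x + g x * (y - x) + L / 2 * (y - x)\<^sup>2"
    by linarith+
qed

text \<open>
  The lower bound at \<open>x\<close> and the upper bound at \<open>y\<close> are compared at the point where the upper
  parabola has the slope \<open>g x\<close>, so that its gap to the tangent at \<open>x\<close> is smallest.
\<close>
lemma taylor_jet_cocoercive:
  assumes J: "taylor_jet L F g" and L: "L > 0"
  shows "(g y - g x)\<^sup>2 \<le> 2 * L * (F y - F x - g x * (y - x))"
proof -
  define \<delta> where "\<delta> = (g y - g x) / L"
  have g: "g y = g x + L * \<delta>"
    using L by (simp add: \<delta>_def)
  have "F x + g x * (y - \<delta> - x) \<le> F y + g y * (y - \<delta> - y) + L / 2 * (y - \<delta> - y)\<^sup>2"
    using taylor_jetD(1)[OF J, of x "y - \<delta>"] taylor_jetD(2)[OF J, of "y - \<delta>" y] by linarith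
  then have "L / 2 * \<delta>\<^sup>2 \<le> F y - F x - g x * (y - x)"
    unfolding g by (simp add: algebra_simps power2_eq_square)
  then have "2 * L * (L / 2 * \<delta>\<^sup>2) \<le> 2 * L * (F y - F x - g x * (y - x))"
    using L by (intro mult_left_mono) auto
  then show ?thesis
    unfolding g by (simp add: algebra_simps power2_eq_square)
qed

text \<open>Adding the cocoercivity bounds for \<open>(x, y)\<close> and \<open>(y, x)\<close> eliminates the values of \<open>F\<close>.\<close>
lemma taylor_jet_slope:
  assumes J: "taylor_jet L F g" and L: "L > 0" and "x \<le> y"
  shows "g x \<le> g y" "g y - g x \<le> L * (y - x)"
proof -
  have "(g y - g x)\<^sup>2 + (g x - g y)\<^sup>2 \<le>
        2 * L * (F y - F x - g x * (y - x)) + 2 * L * (F x - F y - g y * (x - y))"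
    using taylor_jet_cocoercive[OF J L, of y x] taylor_jet_cocoercive[OF J L, of x y] by linarith
  then have *: "(g y - g x) * (g y - g x) \<le> (g y - g x) * (L * (y - x))"
    by (simp add: algebra_simps power2_eq_square)
  have "0 \<le> (g y - g x) * (y - x)"
    using taylor_jetD(1)[OF J, of x y] taylor_jetD(1)[OF J, of y x] by (simp add: algebra_simps)
  then show mono: "g x \<le> g y"
    using \<open>x \<le> y\<close> by (cases "x = y") (auto simp: zero_le_mult_iff)
  show "g y - g x \<le> L * (y - x)"
  proof (cases "g x = g y")
    case True
    then show ?thesis using L \<open>x \<le> y\<close> by simp
  next
    case False
    then have "0 < g y - g x" using mono by simp
    with * show ?thesis using mult_le_cancel_left_pos by blast
  qed
qed

lemma taylor_jet_lipschitz:
  assumes "taylor_jet L F g" "L > 0"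
  shows "\<bar>g x - g y\<bar> \<le> L * \<bar>x - y\<bar>"
proof (cases "x \<le> y")
  case True
  then show ?thesis using taylor_jet_slope[OF assms True] by simp
next
  case False
  then have "y \<le> x" by simp
  then show ?thesis using taylor_jet_slope[OF assms \<open>y \<le> x\<close>] by simp
qed

lemma taylor_jet_has_derivative:
  assumes J: "taylor_jet L F g"
  shows "(F has_real_derivative g x) (at x)"
proof -
  have "\<bar>(F (x + h) - F x) / h - g x\<bar> \<le> L / 2 * \<bar>h\<bar>" if "h \<noteq> 0" for h
  proof -
    have "0 \<le> F (x + h) - F x - g x * h" "F (x + h) - F x - g x * h \<le> L / 2 * h\<^sup>2"
      using taylor_jetD[OF J, where x = x and y = "x + h"] by simp_all
    then have "\<bar>F (x + h) - F x - g x * h\<bar> \<le> (L / 2 * \<bar>h\<bar>) * \<bar>h\<bar>"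
      by (simp add: power2_eq_square)
    then have "\<bar>F (x + h) - F x - g x * h\<bar> / \<bar>h\<bar> \<le> L / 2 * \<bar>h\<bar>"
      using that by (simp add: pos_divide_le_eq)
    moreover have "(F (x + h) - F x) / h - g x = (F (x + h) - F x - g x * h) / h"
      using that by (simp add: field_simps)
    ultimately show ?thesis
      by (simp add: abs_divide)
  qed
  then have "\<forall>\<^sub>F h in at 0. norm ((F (x + h) - F x) / h - g x) \<le> L / 2 * \<bar>h\<bar>"
    by (auto simp: eventually_at_filter)
  moreover have "((\<lambda>h. L / 2 * \<bar>h\<bar>) \<longlongrightarrow> 0) (at 0)"
    by (intro tendsto_mult_right_zero tendsto_rabs_zero tendsto_ident_at)
  ultimately have "((\<lambda>h. (F (x + h) - F x) / h - g x) \<longlongrightarrow> 0) (at 0)"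
    by (rule Lim_null_comparison)
  then show ?thesis
    unfolding DERIV_def by (simp add: LIM_zero_iff)
qed

lemma taylor_jet_affine:
  assumes "L > 0"
  shows "taylor_jet L (\<lambda>t. b + p * (t - c)) (\<lambda>t. p)"
proof -
  have "b + p * (y - c) - (b + p * (x - c)) - p * (y - x) = 0" for x y
    by (simp add: algebra_simps)
  then show ?thesis
    using assms by (simp add: taylor_jet_def)
qed

lemma taylor_jet_parabola:
  assumes "L > 0"
  shows "taylor_jet L (\<lambda>t. b + p * (t - c) + L / 2 * (t - c)\<^sup>2) (\<lambda>t. p + L * (t - c))"
proof -
  have eq: "b + p * (y - c) + L / 2 * (y - c)\<^sup>2 - (b + p * (x - c) + L / 2 * (x - c)\<^sup>2)
          - (p + L * (x - c)) * (y - x) = L / 2 * (y - x)\<^sup>2" for x y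
    by (simp add: field_simps power2_eq_square)
  then show ?thesis
    using assms unfolding taylor_jet_def eq by simp
qed

text \<open>
  For \<open>x\<close> and \<open>y\<close> on different sides of \<open>c\<close>, the Taylor remainder is the sum of the remainders over
  the two parts and of \<open>(g c - g x) * (y - c)\<close>. The upper bounds of these three terms are the
  three terms of \<open>L / 2 * ((c - x) + (y - c))\<^sup>2\<close>.
\<close>
lemma taylor_jet_glue:
  assumes J1: "taylor_jet L F1 g1" and J2: "taylor_jet L F2 g2" and L: "L > 0"
    and F: "F1 c = F2 c" and g: "g1 c = g2 c"
  shows "taylor_jet L (\<lambda>t. if t \<le> c then F1 t else F2 t) (\<lambda>t. if t \<le> c then g1 t else g2 t)"
proof -
  have across: "0 \<le> B - A - q * (y - x) \<and> B - A - q * (y - x) \<le> L / 2 * (y - x)\<^sup>2"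
    if A: "0 \<le> C - A - q * (c - x)" "C - A - q * (c - x) \<le> L / 2 * (c - x)\<^sup>2"
      and B: "0 \<le> B - C - r * (y - c)" "B - C - r * (y - c) \<le> L / 2 * (y - c)\<^sup>2"
      and qr: "0 \<le> (r - q) * (y - c)" "(r - q) * (y - c) \<le> L * (c - x) * (y - c)"
    for A B C q r x y :: real
  proof -
    have "B - A - q * (y - x) = (C - A - q * (c - x)) + (B - C - r * (y - c)) + (r - q) * (y - c)"
      by (simp add: algebra_simps)
    moreover have "L / 2 * (y - x)\<^sup>2 = L / 2 * (c - x)\<^sup>2 + L / 2 * (y - c)\<^sup>2 + L * (c - x) * (y - c)"
      by (simp add: field_simps power2_eq_square)
    ultimately show ?thesis
      using that by linarith
  qed
  note D1 = J1[unfolded taylor_jet_def, rule_format] and D2 = J2[unfolded taylor_jet_def, rule_format]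
  have 1: "0 \<le> F2 y - F1 x - g1 x * (y - x) \<and> F2 y - F1 x - g1 x * (y - x) \<le> L / 2 * (y - x)\<^sup>2"
    if "x \<le> c" "c \<le> y" for x y
  proof (rule across[where C = "F1 c" and r = "g1 c"])
    show "0 \<le> (g1 c - g1 x) * (y - c)"
      using taylor_jet_slope(1)[OF J1 L \<open>x \<le> c\<close>] that by simp
    show "(g1 c - g1 x) * (y - c) \<le> L * (c - x) * (y - c)"
      using taylor_jet_slope(2)[OF J1 L \<open>x \<le> c\<close>] that by (intro mult_right_mono) auto
  qed (use D1[where x = x and y = c] D2[where x = c and y = y] F g in auto)
  have 2: "0 \<le> F1 y - F2 x - g2 x * (y - x) \<and> F1 y - F2 x - g2 x * (y - x) \<le> L / 2 * (y - x)\<^sup>2"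
    if "y \<le> c" "c \<le> x" for x y
  proof (rule across[where C = "F2 c" and r = "g2 c"])
    show "0 \<le> (g2 c - g2 x) * (y - c)"
      using taylor_jet_slope(1)[OF J2 L \<open>c \<le> x\<close>] that by (simp add: mult_nonpos_nonpos)
    have "(g2 x - g2 c) * (c - y) \<le> (L * (x - c)) * (c - y)"
      using taylor_jet_slope(2)[OF J2 L \<open>c \<le> x\<close>] that by (intro mult_right_mono) auto
    then show "(g2 c - g2 x) * (y - c) \<le> L * (c - x) * (y - c)"
      by (simp add: algebra_simps)
  qed (use D1[where x = c and y = y] D2[where x = x and y = c] F g in auto)
  show ?thesis
    unfolding taylor_jet_def using D1 D2 1 2 by auto
qed

section \<open>Interpolation with prescribed derivatives\<close>

text \<open>
  Let the derivative be \<open>p\<close> up to a point \<open>\<tau>\<close>, increase with slope \<open>L\<close> until it reaches \<open>q\<close> at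
  \<open>\<rho>\<close>, and stay \<open>q\<close> from there on. Its integral depends affinely on \<open>\<tau>\<close>, so the condition at
  \<open>b\<close> determines \<open>\<tau>\<close>. The two quadratic hypotheses say exactly that \<open>a \<le> \<tau>\<close> and \<open>\<rho> \<le> b\<close>.
\<close>
lemma two_point_interpolation:
  fixes a b p q A B L :: real
  assumes "a < b" "L > 0"
    and s: "B - A = s * (b - a)" and pq: "p \<le> q"
    and left: "(q - p)\<^sup>2 \<le> 2 * L * (b - a) * (q - s)"
    and right: "(q - p)\<^sup>2 \<le> 2 * L * (b - a) * (s - p)"
  obtains F g where "taylor_jet L F g" "F a = A" "g a = p" "F b = B" "g b = q"
proof (cases "p = q")
  case True
  have "0 < 2 * L * (b - a)" using assms by simp
  then have "s = p"
    using left right True by (simp add: zero_le_mult_iff)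
  then show ?thesis
    using s True that[OF taylor_jet_affine[OF \<open>L > 0\<close>, of A p a]] by simp
next
  case False
  define w where "w = q - p"
  have w: "w > 0" "q = p + w" using pq False by (auto simp: w_def)
  define e where "e = w / (2 * L)"
  define X where "X = (q - s) * (b - a) / w"
  define \<tau> where "\<tau> = a + X - e"
  define \<rho> where "\<rho> = \<tau> + w / L"
  have e: "w / L = 2 * e" "0 \<le> e" using w \<open>L > 0\<close> by (auto simp: e_def)
  have "e \<le> X"
    using left w \<open>L > 0\<close> by (simp add: e_def X_def field_simps power2_eq_square)
  then have \<tau>: "a \<le> \<tau>" by (simp add: \<tau>_def)
  have "e \<le> (s - p) * (b - a) / w"
    using right w \<open>L > 0\<close> by (simp add: e_def field_simps power2_eq_square)
  also have "\<dots> = (b - a) - X"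
    using w by (simp add: X_def field_simps)
  finally have \<rho>: "\<rho> \<le> b" unfolding \<rho>_def \<tau>_def e by linarith
  have "\<tau> < \<rho>" using w \<open>L > 0\<close> by (simp add: \<rho>_def)
  define F1 where "F1 = (\<lambda>t. A + p * (t - a))"
  define F2 where "F2 = (\<lambda>t. F1 \<tau> + p * (t - \<tau>) + L / 2 * (t - \<tau>)\<^sup>2)"
  define F3 where "F3 = (\<lambda>t. F2 \<rho> + q * (t - \<rho>))"
  define g2 where "g2 = (\<lambda>t. p + L * (t - \<tau>))"
  define G where "G = (\<lambda>t. if t \<le> \<tau> then F1 t else F2 t)"
  define h where "h = (\<lambda>t. if t \<le> \<tau> then p else g2 t)"
  have J1: "taylor_jet L F1 (\<lambda>t. p)"
    unfolding F1_def by (rule taylor_jet_affine[OF \<open>L > 0\<close>])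
  have J2: "taylor_jet L F2 g2"
    unfolding F2_def g2_def by (rule taylor_jet_parabola[OF \<open>L > 0\<close>])
  have J3: "taylor_jet L F3 (\<lambda>t. q)"
    unfolding F3_def by (rule taylor_jet_affine[OF \<open>L > 0\<close>])
  have J12: "taylor_jet L G h"
    unfolding G_def h_def by (rule taylor_jet_glue[OF J1 J2 \<open>L > 0\<close>]) (simp_all add: F2_def g2_def)
  have G\<rho>: "G \<rho> = F2 \<rho>" "h \<rho> = q"
    using \<open>\<tau> < \<rho>\<close> w \<open>L > 0\<close> by (simp_all add: G_def h_def g2_def) (simp add: \<rho>_def)
  have J: "taylor_jet L (\<lambda>t. if t \<le> \<rho> then G t else F3 t) (\<lambda>t. if t \<le> \<rho> then h t else q)"
    by (rule taylor_jet_glue[OF J12 J3 \<open>L > 0\<close>]) (simp_all add: G\<rho> F3_def)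
  have "F3 b = A + p * (\<tau> - a) + p * (w / L) + L / 2 * (w / L)\<^sup>2 + q * (b - \<tau> - w / L)"
    by (simp add: F3_def F2_def F1_def \<rho>_def algebra_simps)
  also have "\<dots> = A + q * (b - a) - w * (\<tau> - a) - w\<^sup>2 / (2 * L)"
    using \<open>L > 0\<close> unfolding w(2) by (simp add: field_simps power2_eq_square)
  also have "w * (\<tau> - a) = (q - s) * (b - a) - w\<^sup>2 / (2 * L)"
  proof -
    have "w * X = (q - s) * (b - a)" "w * e = w\<^sup>2 / (2 * L)"
      using w(1) by (simp_all add: X_def e_def power2_eq_square)
    then show ?thesis by (simp add: \<tau>_def right_diff_distrib)
  qed
  finally have "F3 b = B" using s by (simp add: algebra_simps)
  moreover have "G a = A" "h a = p" using \<tau> by (auto simp: G_def F1_def h_def)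
  moreover have "a \<le> \<rho>" using \<tau> \<open>\<tau> < \<rho>\<close> by simp
  moreover have "G b = F3 b \<and> h b = q" if "b \<le> \<rho>"
    using that \<rho> G\<rho> by (simp add: F3_def)
  ultimately show ?thesis
    using that[OF J] by auto
qed

lemma chain_interpolation:
  fixes x F0 p s :: "nat \<Rightarrow> real"
  assumes L: "L > 0"
    and inc: "\<And>i. i < n \<Longrightarrow> x i < x (Suc i)"
    and s: "\<And>i. i < n \<Longrightarrow> F0 (Suc i) - F0 i = s i * (x (Suc i) - x i)"
    and mono: "\<And>i. i < n \<Longrightarrow> p i \<le> p (Suc i)"
    and left: "\<And>i. i < n \<Longrightarrow> (p (Suc i) - p i)\<^sup>2 \<le> 2 * L * (x (Suc i) - x i) * (p (Suc i) - s i)"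
    and right: "\<And>i. i < n \<Longrightarrow> (p (Suc i) - p i)\<^sup>2 \<le> 2 * L * (x (Suc i) - x i) * (s i - p i)"
  shows "\<exists>F g. taylor_jet L F g \<and> (\<forall>j\<le>n. F (x j) = F0 j)"
proof -
  have "\<exists>F g. taylor_jet L F g \<and> (\<forall>j\<le>k. F (x j) = F0 j \<and> x j \<le> x k) \<and> g (x k) = p k" if "k \<le> n" for k
    using that
  proof (induction k)
    case 0
    show ?case
      using taylor_jet_affine[OF L, of "F0 0" "p 0" "x 0"]       by (intro exI[of _ "\<lambda>t. F0 0 + p 0 * (t - x 0)"] exI[of _ "\<lambda>t. p 0"]) auto
  next
    case (Suc k)
    then obtain F g where J: "taylor_jet L F g" "\<forall>j\<le>k. F (x j) = F0 j \<and> x j \<le> x k" "g (x k) = p k"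
      by auto
    have k: "k < n" using Suc.prems by simp
    obtain G h where G: "taylor_jet L G h" "G (x k) = F0 k" "h (x k) = p k"
        "G (x (Suc k)) = F0 (Suc k)" "h (x (Suc k)) = p (Suc k)"
      using two_point_interpolation[OF inc[OF k] L s[OF k] mono[OF k] left[OF k] right[OF k]] .
    have "taylor_jet L (\<lambda>t. if t \<le> x k then F t else G t) (\<lambda>t. if t \<le> x k then g t else h t)"
      using J G L by (intro taylor_jet_glue) auto
    then show ?case
      using J G inc[OF k]
      by (intro exI[of _ "\<lambda>t. if t \<le> x k then F t else G t"] exI[of _ "\<lambda>t. if t \<le> x k then g t else h t"])
         (auto simp: le_Suc_eq)
  qed
  then show ?thesis by blast
qed

section \<open>Dividing the jumps of the slopes\<close>

text \<open>
  These are the necessary conditions on the two one-sided gaps between the secant slope and the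
  end derivatives. The last two hold because either gap is at most \<open>g b - g a\<close>, to which
  cocoercivity applies from both ends.
\<close>
lemma taylor_jet_secant:
  assumes J: "taylor_jet m F g" and m: "m > 0" and "a < b"
    and s: "F b - F a = s * (b - a)"
  shows "0 \<le> s - g a" "0 \<le> g b - s"
    "s - g a \<le> m * (b - a) / 2" "g b - s \<le> m * (b - a) / 2"
    "(s - g a)\<^sup>2 \<le> 2 * (m * (b - a)) * (g b - s)" "(g b - s)\<^sup>2 \<le> 2 * (m * (b - a)) * (s - g a)"
proof -
  have 1: "0 \<le> (s - g a) * (b - a)" "(s - g a) * (b - a) \<le> (m * (b - a) / 2) * (b - a)"
    using taylor_jetD[OF J, where x = a and y = b] s by (auto simp: algebra_simps power2_eq_square)
  have 2: "0 \<le> (g b - s) * (b - a)" "(g b - s) * (b - a) \<le> (m * (b - a) / 2) * (b - a)"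
    using taylor_jetD[OF J, where x = b and y = a] s by (auto simp: algebra_simps power2_eq_square)
  show u: "0 \<le> s - g a" and v: "0 \<le> g b - s"
    using 1(1) 2(1) \<open>a < b\<close> by (auto simp: zero_le_mult_iff)
  show "s - g a \<le> m * (b - a) / 2" "g b - s \<le> m * (b - a) / 2"
    using 1(2) 2(2) \<open>a < b\<close> by (auto simp: mult_le_cancel_right)
  have "(s - g a)\<^sup>2 \<le> (g b - g a)\<^sup>2" "(g b - s)\<^sup>2 \<le> (g b - g a)\<^sup>2"
    using u v by (auto intro!: power_mono)
  moreover have "(g b - g a)\<^sup>2 \<le> 2 * (m * (b - a)) * (s - g a)"
  proof -
    have "F b - F a - g a * (b - a) = (b - a) * (s - g a)" using s by (simp add: algebra_simps)
    then show ?thesis using taylor_jet_cocoercive[OF J m, of b a] by (simp add: mult.assoc)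
  qed
  moreover have "(g b - g a)\<^sup>2 \<le> 2 * (m * (b - a)) * (g b - s)"
  proof -
    have "F a - F b - g b * (a - b) = (b - a) * (g b - s)" using s by (simp add: algebra_simps)
    then show ?thesis
      using taylor_jet_cocoercive[OF J m, of a b] by (simp add: mult.assoc power2_commute[of "g b"])
  qed
  ultimately show "(s - g a)\<^sup>2 \<le> 2 * (m * (b - a)) * (g b - s)"
      "(g b - s)\<^sup>2 \<le> 2 * (m * (b - a)) * (s - g a)" by linarith+
qed

text \<open>
  The bound for the gap at one end of an interval, where \<open>a\<close> is the Lipschitz constant times the
  length, \<open>D\<close> the jump of the slopes at that end and \<open>D'\<close> the jump at the other end: the gap is
  part of \<open>D\<close>, and the gap at the other end is part of \<open>D'\<close>.
\<close>
definition cap :: "real \<Rightarrow> real \<Rightarrow> real \<Rightarrow> real" where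
  "cap a D D' = min D (min (a / 2) (sqrt (2 * a * D')))"

text \<open>
  The caps themselves satisfy the quadratic relation that \<open>taylor_jet_secant\<close> gives for the gaps
  of an actual function.
\<close>
lemma cap_square_le:
  assumes "a > 0" "D \<ge> 0" "D' \<ge> 0"
  shows "(cap a D D')\<^sup>2 \<le> 2 * a * cap a D' D"
proof -
  define u where "u = cap a D D'"
  have u: "0 \<le> u" "u \<le> D" "u \<le> a / 2" "u \<le> sqrt (2 * a * D')"
    using assms by (auto simp: u_def cap_def)
  have "u\<^sup>2 \<le> 2 * a * D'"
    using u(1,4) assms by (metis power_mono real_sqrt_pow2 mult_nonneg_nonneg less_imp_le zero_le_numeral)
  moreover have "u\<^sup>2 \<le> 2 * a * (a / 2)"
    using mult_mono[of u a u a] u assms by (simp add: power2_eq_square)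
  moreover have "u\<^sup>2 \<le> 2 * a * sqrt (2 * a * D)"
  proof -
    have "u\<^sup>2 \<le> 2 * a * D"
      using mult_mono[of u "2 * a" u D] u assms by (simp add: power2_eq_square)
    then have "u \<le> sqrt (2 * a * D)" using u(1) by (simp add: real_le_rsqrt)
    moreover have "u * u \<le> 2 * a * u" using u assms by (intro mult_right_mono) auto
    moreover have "2 * a * u \<le> 2 * a * sqrt (2 * a * D)" using calculation assms by (intro mult_left_mono) auto
    ultimately show ?thesis by (simp add: power2_eq_square)
  qed
  ultimately show ?thesis
    using assms unfolding u_def[symmetric] by (simp add: cap_def min_def)
qed

text \<open>
  With \<open>U\<close> and \<open>V\<close> the two caps, the terms of \<open>(U + V)\<^sup>2 = U\<^sup>2 + 2 * U * V + V\<^sup>2\<close> are at most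
  \<open>a / 2 * U\<close>, \<open>a * U\<close> and \<open>2 * a * U\<close>, whence the constant \<open>7 / 2\<close>; replacing \<open>U\<close> by
  \<open>u \<ge> U / 2\<close> costs the remaining factor \<open>2\<close>.
\<close>
lemma half_caps_compatible:
  assumes a: "a > 0" and D: "D \<ge> 0" "D' \<ge> 0"
    and u: "cap a D D' / 2 \<le> u" "u \<le> cap a D D'"
    and v: "cap a D' D / 2 \<le> v" "v \<le> cap a D' D"
  shows "(u + v)\<^sup>2 \<le> 2 * (7 / 2 * a) * u" "(u + v)\<^sup>2 \<le> 2 * (7 / 2 * a) * v"
proof -
  have sym: "(U + V)\<^sup>2 \<le> 7 / 2 * a * U"
    if "0 \<le> U" "0 \<le> V" "U \<le> a / 2" "V \<le> a / 2" "V\<^sup>2 \<le> 2 * a * U" for U V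
  proof -
    have "U * U \<le> (a / 2) * U" using that by (intro mult_right_mono) auto
    moreover have "U * V \<le> U * (a / 2)" using that by (intro mult_left_mono) auto
    ultimately show ?thesis using that(5) by (simp add: power2_eq_square algebra_simps)
  qed
  define U V where "U = cap a D D'" and "V = cap a D' D"
  have UV: "0 \<le> U" "0 \<le> V" "U \<le> a / 2" "V \<le> a / 2"
    using a D by (auto simp: U_def V_def cap_def)
  have "(U + V)\<^sup>2 \<le> 7 / 2 * a * U"
    using sym[OF UV] cap_square_le[OF a D(2,1)] by (simp add: U_def V_def)
  moreover have "(U + V)\<^sup>2 \<le> 7 / 2 * a * V"
    using sym[OF UV(2,1,4,3)] cap_square_le[OF a D] by (simp add: U_def V_def add.commute)
  moreover have "7 / 2 * a * U \<le> 2 * (7 / 2 * a) * u" "7 / 2 * a * V \<le> 2 * (7 / 2 * a) * v"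
    using mult_left_mono[OF u(1), of "7 * a"] mult_left_mono[OF v(1), of "7 * a"] a
    by (auto simp: U_def V_def)
  moreover have "(u + v)\<^sup>2 \<le> (U + V)\<^sup>2"
    using u v UV by (intro power_mono) (auto simp: U_def V_def)
  ultimately show "(u + v)\<^sup>2 \<le> 2 * (7 / 2 * a) * u" "(u + v)\<^sup>2 \<le> 2 * (7 / 2 * a) * v"
    by linarith+
qed

text \<open>
  The scaling factor \<open>D / (V + U)\<close> is at most \<open>1\<close> by the last hypothesis and at least \<open>1 / 2\<close>
  because \<open>U\<close> and \<open>V\<close> are at most \<open>D\<close>. If \<open>V + U = 0\<close>, then everything vanishes.
\<close>
lemma proportional_split:
  fixes D U V :: real
  assumes "0 \<le> U" "0 \<le> V" "U \<le> D" "V \<le> D" "D \<le> V + U"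
  shows "U / 2 \<le> D * U / (V + U)" "D * U / (V + U) \<le> U"
    "V / 2 \<le> D - D * U / (V + U)" "D - D * U / (V + U) \<le> V"
proof -
  have *: "X / 2 \<le> D * X / (V + U) \<and> D * X / (V + U) \<le> X" if X: "0 \<le> X" and pos: "0 < V + U" for X
  proof -
    have "(V + U) * X \<le> (2 * D) * X" "D * X \<le> (V + U) * X"
      using assms X by (auto intro!: mult_right_mono)
    then show ?thesis using pos by (simp add: field_simps)
  qed
  have "U / 2 \<le> D * U / (V + U) \<and> D * U / (V + U) \<le> U \<and>
        V / 2 \<le> D - D * U / (V + U) \<and> D - D * U / (V + U) \<le> V"
  proof (cases "V + U = 0")
    case True
    then show ?thesis using assms by auto
  next
    case False
    then have pos: "0 < V + U" using assms by auto
    have "D - D * U / (V + U) = D * V / (V + U)" using pos by (simp add: field_simps)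
    then show ?thesis using *[OF assms(1) pos] *[OF assms(2) pos] by simp
  qed
  then show "U / 2 \<le> D * U / (V + U)" "D * U / (V + U) \<le> U"
    "V / 2 \<le> D - D * U / (V + U)" "D - D * U / (V + U) \<le> V" by auto
qed

section \<open>Finite sets\<close>

text \<open>
  A window consists of an index and its at most two neighbours on either side. Its interpolant is
  used only to bound the jump at the middle index by the sum of the two caps that compete for it:
  the gaps next to the middle point are bounded through the jumps at the next points, and
  those need one further point each.
\<close>
lemma sequence_interpolation:
  fixes x F0 :: "nat \<Rightarrow> real"
  assumes m: "m > 0" and n: "n > 0"
    and inc: "\<And>i. i < n \<Longrightarrow> x i < x (Suc i)"
    and window: "\<And>k. \<exists>F g. taylor_jet m F g \<and> (\<forall>j\<le>n. k \<le> j + 2 \<and> j \<le> k + 2 \<longrightarrow> F (x j) = F0 j)"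
  shows "\<exists>F g. taylor_jet (7 / 2 * m) F g \<and> (\<forall>j\<le>n. F (x j) = F0 j)"
proof -
  define d where "d i = x (Suc i) - x i" for i
  define a where "a i = m * d i" for i
  define s where "s i = (F0 (Suc i) - F0 i) / d i" for i
  \<comment> \<open>There is no jump at the two end points. The value \<open>a\<close> there makes the square root in the cap
      exceed \<open>a / 2\<close>, so an end point imposes no restriction on the cap at the other end.\<close>
  define D where "D i = (if i = 0 then a 0 else if i = n then a (n - 1) else s i - s (i - 1))" for i
  define U where "U i = cap (a i) (D i) (D (Suc i))" for i
  define V where "V i = cap (a i) (D (Suc i)) (D i)" for i
  have d: "d i > 0" if "i < n" for i
    using inc[OF that] by (simp add: d_def)
  have a: "a i > 0" if "i < n" for i
    using d[OF that] m by (simp add: a_def)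
  have s: "F0 (Suc i) - F0 i = s i * (x (Suc i) - x i)" if "i < n" for i
    using d[OF that] by (simp add: s_def flip: d_def)
  have DS: "D (Suc k) = s (Suc k) - s k" if "Suc k < n" for k
    using that by (simp add: D_def)
  have secant: "0 \<le> s i - g (x i)" "0 \<le> g (x (Suc i)) - s i"
      "s i - g (x i) \<le> a i / 2" "g (x (Suc i)) - s i \<le> a i / 2"
      "(s i - g (x i))\<^sup>2 \<le> 2 * a i * (g (x (Suc i)) - s i)"
      "(g (x (Suc i)) - s i)\<^sup>2 \<le> 2 * a i * (s i - g (x i))"
    if "taylor_jet m F g" "i < n" "F (x i) = F0 i" "F (x (Suc i)) = F0 (Suc i)" for F g i
    using taylor_jet_secant[OF that(1) m inc[OF that(2)], of "s i"] s[OF that(2)] that(3,4)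
    by (auto simp: a_def d_def)
  \<comment> \<open>Here the five points enter: the derivative of the window's interpolant at the middle point
      divides the jump into two parts that respect the caps.\<close>
  have D_caps: "0 \<le> D (Suc k) \<and> D (Suc k) \<le> V k + U (Suc k)" if k: "Suc k < n" for k
  proof -
    obtain F g where J: "taylor_jet m F g"
      and F: "\<forall>j\<le>n. Suc k \<le> j + 2 \<and> j \<le> Suc k + 2 \<longrightarrow> F (x j) = F0 j"
      using window[of "Suc k"] by blast
    define v where "v = g (x (Suc k)) - s k"
    define u where "u = s (Suc k) - g (x (Suc k))"
    have k1: "F (x k) = F0 k" "F (x (Suc k)) = F0 (Suc k)" "F (x (Suc (Suc k))) = F0 (Suc (Suc k))"
      using F k by auto
    note left = secant[OF J _ k1(1,2)] and right = secant[OF J k k1(2,3)]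
    have kn: "k < n" using k by simp
    have uv: "0 \<le> v" "v \<le> a k / 2" "0 \<le> u" "u \<le> a (Suc k) / 2"
      using left(2,4)[OF kn] right(1,3) by (auto simp: u_def v_def)
    have sum: "D (Suc k) = v + u"
      by (simp add: DS[OF k] u_def v_def)
    \<comment> \<open>The far gap on the left interval is part of the jump at \<open>x k\<close>, or at most \<open>a k / 2\<close> if
        \<open>x k\<close> is an end point.\<close>
    have "s k - g (x k) \<le> D k"
    proof (cases k)
      case 0
      then show ?thesis using left(3)[OF kn] a[OF kn] by (simp add: D_def)
    next
      case (Suc j)
      then have "0 \<le> g (x k) - s j"
        using secant(2)[OF J, of j] F k k1 by auto
      then show ?thesis using DS[of j] Suc k by simp
    qed
    then have "2 * a k * (s k - g (x k)) \<le> 2 * a k * D k"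
      using a[OF kn] by (intro mult_left_mono) auto
    then have "v \<le> sqrt (2 * a k * D k)"
      using left(6)[OF kn] uv by (intro real_le_rsqrt) (simp add: v_def)
    then have "v \<le> V k"
      using uv sum by (simp add: V_def cap_def)
    have "g (x (Suc (Suc k))) - s (Suc k) \<le> D (Suc (Suc k))"
    proof (cases "Suc (Suc k) = n")
      case True
      then have "D (Suc (Suc k)) = a (Suc k)" unfolding D_def by (simp flip: True)
      then show ?thesis using right(4) a[OF k] by simp
    next
      case False
      then have "Suc (Suc k) < n" using k by simp
      then have "0 \<le> s (Suc (Suc k)) - g (x (Suc (Suc k)))"
        using secant(1)[OF J, of "Suc (Suc k)"] F k1 by auto
      then show ?thesis using DS[OF \<open>Suc (Suc k) < n\<close>] by simp
    qed
    then have "2 * a (Suc k) * (g (x (Suc (Suc k))) - s (Suc k)) \<le> 2 * a (Suc k) * D (Suc (Suc k))"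
      using a[OF k] by (intro mult_left_mono) auto
    then have "u \<le> sqrt (2 * a (Suc k) * D (Suc (Suc k)))"
      using right(5) uv by (intro real_le_rsqrt) (simp add: u_def)
    then have "u \<le> U (Suc k)"
      using uv sum by (simp add: U_def cap_def)
    then show ?thesis
      using \<open>v \<le> V k\<close> uv sum by simp
  qed
  have D: "0 \<le> D i" if "i \<le> n" for i
  proof (cases "i = 0 \<or> i = n")
    case True
    then show ?thesis using a[of 0] a[of "n - 1"] n by (auto simp: D_def)
  next
    case False
    then show ?thesis using D_caps[of "i - 1"] that by simp
  qed
  have U: "0 \<le> U i" "U i \<le> D i" and V: "0 \<le> V i" "V i \<le> D (Suc i)" if "i < n" for i
    using a[OF that] D[of i] D[of "Suc i"] that by (auto simp: U_def V_def cap_def)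
  \<comment> \<open>Inside, the jump is divided in the proportion of the two caps; at the ends, the full cap is
      taken.\<close>
  define p where "p i = (if i = 0 then s 0 - U 0 else if i = n then s (n - 1) + V (n - 1)
      else s i - D i * U i / (V (i - 1) + U i))" for i
  have u: "U i / 2 \<le> s i - p i \<and> s i - p i \<le> U i" if "i < n" for i
  proof (cases i)
    case 0
    then show ?thesis using U[OF that] by (simp add: p_def)
  next
    case (Suc k)
    then have "p i = s i - D i * U i / (V k + U i)" using that by (simp add: p_def)
    then show ?thesis
      using proportional_split[of "U i" "V k" "D i"] U[OF that] V[of k] D_caps[of k] that Suc by simp
  qed
  have v: "V i / 2 \<le> p (Suc i) - s i \<and> p (Suc i) - s i \<le> V i" if "i < n" for i
  proof (cases "Suc i = n")
    case True
    then have "p (Suc i) = s i + V i" by (auto simp: p_def)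
    then show ?thesis using V[OF that] by simp
  next
    case False
    then have i: "Suc i < n" using that by simp
    then have "p (Suc i) - s i = D (Suc i) - D (Suc i) * U (Suc i) / (V i + U (Suc i))"
      using DS[OF i] by (simp add: p_def)
    then show ?thesis
      using proportional_split[of "U (Suc i)" "V i" "D (Suc i)"] U[OF i] V[OF that] D_caps[OF i] by simp
  qed
  have ok: "p i \<le> p (Suc i)"
      "(p (Suc i) - p i)\<^sup>2 \<le> 2 * (7 / 2 * m) * (x (Suc i) - x i) * (p (Suc i) - s i)"
      "(p (Suc i) - p i)\<^sup>2 \<le> 2 * (7 / 2 * m) * (x (Suc i) - x i) * (s i - p i)" if "i < n" for i
  proof -
    have "i \<le> n" "Suc i \<le> n" using that by auto
    note c = half_caps_compatible[OF a[OF that] D[OF this(1)] D[OF this(2)],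
        folded U_def V_def, of "s i - p i" "p (Suc i) - s i"]
    show "p i \<le> p (Suc i)" using u[OF that] v[OF that] U[OF that] V[OF that] by linarith
    show "(p (Suc i) - p i)\<^sup>2 \<le> 2 * (7 / 2 * m) * (x (Suc i) - x i) * (p (Suc i) - s i)"
      "(p (Suc i) - p i)\<^sup>2 \<le> 2 * (7 / 2 * m) * (x (Suc i) - x i) * (s i - p i)"
      using c u[OF that] v[OF that] by (simp_all add: a_def d_def mult.assoc)
  qed
  show ?thesis
    by (rule chain_interpolation[where s = s and p = p]) (use m inc s ok in auto)
qed

lemma finite_set_interpolation:
  assumes m: "m > 0" and fin: "finite S"
    and five: "\<And>T. T \<subseteq> S \<Longrightarrow> card T \<le> 5 \<Longrightarrow> \<exists>F g. taylor_jet m F g \<and> (\<forall>x\<in>T. F x = f x)"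
  shows "\<exists>F g. taylor_jet (7 / 2 * m) F g \<and> (\<forall>x\<in>S. F x = f x)"
proof (cases "card S \<le> 1")
  case True
  have "\<exists>c. S \<subseteq> {c}"
  proof (cases "card S = 0")
    case False
    then have "card S = 1" using True by linarith
    then show ?thesis by (auto simp: card_1_singleton_iff)
  qed (use fin in auto)
  then obtain c where c: "S \<subseteq> {c}" by blast
  show ?thesis
    using c m taylor_jet_affine[of "7 / 2 * m" "f c" 0 c]
    by (intro exI[of _ "\<lambda>t. f c + 0 * (t - c)"] exI[of _ "\<lambda>t. 0"]) auto
next
  case False
  define n where "n = card S - 1"
  define x where "x i = sorted_list_of_set S ! i" for i
  have len: "length (sorted_list_of_set S) = Suc n" and n: "n > 0"
    using False by (auto simp: n_def)
  have set: "x ` {..n} = S"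
  proof -
    have "x ` {..n} = x ` {..<card S}"
      using False by (simp add: n_def flip: lessThan_Suc_atMost)
    also have "\<dots> = set (sorted_list_of_set S)"
      by (auto simp: x_def set_conv_nth)
    finally show ?thesis using fin by simp
  qed
  have inc: "x i < x (Suc i)" if "i < n" for i
    unfolding x_def
    by (rule sorted_wrt_nth_less[OF strict_sorted_list_of_set]) (use that len in auto)
  have "\<exists>F g. taylor_jet m F g \<and> (\<forall>j\<le>n. k \<le> j + 2 \<and> j \<le> k + 2 \<longrightarrow> F (x j) = f (x j))" for k
  proof -
    define I where "I = {j. j \<le> n \<and> k \<le> j + 2 \<and> j \<le> k + 2}"
    have "I \<subseteq> {k - 2..k + 2}" by (auto simp: I_def)
    then have "card I \<le> card {k - 2..k + 2}" by (intro card_mono) auto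
    then have "card (x ` I) \<le> 5"
      using card_image_le[of I x] by (simp add: I_def)
    moreover have "x ` I \<subseteq> S" using set by (auto simp: I_def)
    ultimately show ?thesis
      using five[of "x ` I"] by (auto simp: I_def)
  qed
  then have "\<exists>F g. taylor_jet (7 / 2 * m) F g \<and> (\<forall>j\<le>n. F (x j) = f (x j))"
    using sequence_interpolation[OF m n, of x "\<lambda>j. f (x j)"] inc by blast
  then show ?thesis
    unfolding set[symmetric] by auto
qed

section \<open>Infinite sets\<close>

text \<open>
  Two points \<open>a\<close> and \<open>b\<close> of the set pin down the derivative at \<open>a\<close> up to \<open>L / 2 * (b - a)\<close>, and
  with it value and derivative at every \<open>x\<close> up to bounds \<open>R x\<close> and \<open>Q x\<close> that depend only on the data.
  All interpolants that meet the data at \<open>a\<close> and \<open>b\<close> thus lie in a product of compact rectangles,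
  and the finite intersection property applies to the closed conditions at the single points.
\<close>
lemma interpolation_by_compactness:
  assumes L: "L > 0"
    and fin: "\<And>S. S \<subseteq> E \<Longrightarrow> finite S \<Longrightarrow> \<exists>F g. taylor_jet L F g \<and> (\<forall>x\<in>S. F x = f x)"
  shows "\<exists>F g. taylor_jet L F g \<and> (\<forall>x\<in>E. F x = f x)"
proof (cases "\<exists>a b. a \<in> E \<and> b \<in> E \<and> a < b")
  case False
  then have "E = {} \<or> (\<exists>c. E = {c})"
    by (metis insertI1 linorder_neqE subsetI subset_singleton_iff singletonD)
  then have "finite E" by auto
  then show ?thesis using fin by blast
next
  case True
  then obtain a b where ab: "a \<in> E" "b \<in> E" "a < b" by blast
  define P where "P = \<bar>(f b - f a) / (b - a)\<bar> + L / 2 * (b - a)"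
  define R where "R x = \<bar>f a\<bar> + P * \<bar>x - a\<bar> + L / 2 * (x - a)\<^sup>2" for x
  define Q where "Q x = P + L * \<bar>x - a\<bar>" for x
  define K where "K = (\<Pi>\<^sub>E x\<in>UNIV. {- R x..R x} \<times> {- Q x..Q x})"
  define J where "J e = {h :: real \<Rightarrow> real \<times> real.
      taylor_jet L (\<lambda>x. fst (h x)) (\<lambda>x. snd (h x)) \<and> fst (h e) = f e}" for e
  have bound: "\<bar>F x\<bar> \<le> R x" "\<bar>g x\<bar> \<le> Q x"
    if T: "taylor_jet L F g" and F: "F a = f a" "F b = f b" for F g x
  proof -
    define s where "s = (f b - f a) / (b - a)"
    have "F b - F a = s * (b - a)" using ab F by (simp add: s_def)
    then have "\<bar>s - g a\<bar> \<le> L * (b - a) / 2"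
      using taylor_jet_secant(1,3)[OF T L ab(3)] by simp
    moreover have "\<bar>g a\<bar> \<le> \<bar>s\<bar> + \<bar>s - g a\<bar>" by linarith
    ultimately have ga: "\<bar>g a\<bar> \<le> P" unfolding P_def s_def[symmetric] by simp
    then have "\<bar>g a * (x - a)\<bar> \<le> P * \<bar>x - a\<bar>"
      by (simp add: abs_mult mult_right_mono)
    then show "\<bar>F x\<bar> \<le> R x"
      using taylor_jetD[OF T, where x = a and y = x] F(1) unfolding R_def by linarith
    show "\<bar>g x\<bar> \<le> Q x"
      using taylor_jet_lipschitz[OF T L, of x a] ga by (simp add: Q_def)
  qed
  have compact: "compact K"
  proof -
    have "compactin (product_topology (\<lambda>_. euclidean) UNIV) K"
      unfolding K_def by (subst compactin_PiE) (auto intro: compact_Times)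
    then show ?thesis by (simp add: euclidean_product_topology)
  qed
  have closed: "closed (J e)" for e
    unfolding J_def taylor_jet_def
    by (intro closed_Collect_conj closed_Collect_all closed_Collect_le closed_Collect_eq
        continuous_intros continuous_on_fst continuous_on_snd continuous_on_product_coordinates)
  have fip: "K \<inter> (\<Inter>e\<in>S. J e) \<noteq> {}" if S: "finite S" "S \<subseteq> E" for S
  proof -
    obtain F g where T: "taylor_jet L F g" and F: "\<forall>x\<in>insert a (insert b S). F x = f x"
      using fin[of "insert a (insert b S)"] S ab by auto
    have "\<bar>F x\<bar> \<le> R x \<and> \<bar>g x\<bar> \<le> Q x" for x
      using bound[OF T] F by simp
    then have "(\<lambda>x. (F x, g x)) \<in> K"
      by (simp add: K_def PiE_UNIV_domain Pi_iff abs_le_iff minus_le_iff)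
    moreover have "(\<lambda>x. (F x, g x)) \<in> J e" if "e \<in> S" for e
      using T F that by (simp add: J_def)
    ultimately show ?thesis by blast
  qed
  have "K \<inter> (\<Inter>e\<in>E. J e) \<noteq> {}"
    by (rule compact_imp_fip_image[OF compact closed fip])
  then obtain h where h: "\<And>e. e \<in> E \<Longrightarrow> h \<in> J e" by blast
  have "taylor_jet L (\<lambda>x. fst (h x)) (\<lambda>x. snd (h x))" "\<forall>e\<in>E. fst (h e) = f e"
    using h[OF ab(1)] h by (simp_all add: J_def)
  then show ?thesis
    by (intro exI[of _ "\<lambda>x. fst (h x)"] exI[of _ "\<lambda>x. snd (h x)"]) simp
qed

section \<open>The strongly convex class\<close>

text \<open>
  Both Taylor bounds are tangent inequalities: one for the convex function
  \<open>F x - \<eta> / 2 * x\<^sup>2\<close>, the other for \<open>M / 2 * x\<^sup>2 - F x\<close>, whose derivative is increasing since that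
  of \<open>F\<close> has Lipschitz constant \<open>M\<close>.
\<close>
lemma strongly_convex_imp_taylor_jet:
  assumes F: "F \<in> C11c" "strongly_convex \<eta> F" "Lip (deriv F) \<le> ereal M" and "M \<ge> 0"
  shows "taylor_jet (M - \<eta>) (\<lambda>x. F x - \<eta> / 2 * x\<^sup>2) (\<lambda>x. deriv F x - \<eta> * x)"
proof -
  have dF: "(F has_real_derivative deriv F x) (at x)" for x
    using F(1) by (simp add: C11c_def differentiable_on_def DERIV_deriv_iff_real_differentiable)
  have lip: "deriv F y - deriv F x \<le> M * (y - x)" if "x \<le> y" for x y
  proof -
    have "M-lipschitz_on UNIV (deriv F)" using F(3) Lip_le_iff[OF \<open>M \<ge> 0\<close>] by blast
    then have "dist (deriv F y) (deriv F x) \<le> M * dist y x" by (auto simp: lipschitz_on_def)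
    then show ?thesis using that by (simp add: dist_real_def)
  qed
  have lower: "F y - \<eta> / 2 * y\<^sup>2 - (F x - \<eta> / 2 * x\<^sup>2) \<ge> (deriv F x - \<eta> * x) * (y - x)" for x y
  proof (rule convex_on_imp_above_tangent[where A = UNIV and f = "\<lambda>t. F t - \<eta> / 2 * t\<^sup>2"])
    show "convex_on UNIV (\<lambda>t. F t - \<eta> / 2 * t\<^sup>2)"
      using F(2) by (simp add: strongly_convex_def)
    show "((\<lambda>t. F t - \<eta> / 2 * t\<^sup>2) has_real_derivative deriv F x - \<eta> * x) (at x within UNIV)"
      by (auto intro!: derivative_eq_intros dF)
  qed auto
  have upper: "M / 2 * y\<^sup>2 - F y - (M / 2 * x\<^sup>2 - F x) \<ge> (M * x - deriv F x) * (y - x)" for x y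
  proof (rule convex_on_imp_above_tangent[where A = UNIV and f = "\<lambda>t. M / 2 * t\<^sup>2 - F t"])
    have d: "((\<lambda>t. M / 2 * t\<^sup>2 - F t) has_real_derivative M * x - deriv F x) (at x)" for x
      by (auto intro!: derivative_eq_intros dF)
    then show "((\<lambda>t. M / 2 * t\<^sup>2 - F t) has_real_derivative M * x - deriv F x) (at x within UNIV)" .
    show "convex_on UNIV (\<lambda>t. M / 2 * t\<^sup>2 - F t)"
      by (rule convex_on_realI[where f' = "\<lambda>x. M * x - deriv F x"])
         (use d lip in \<open>auto simp: algebra_simps\<close>)
  qed auto
  show ?thesis
    unfolding taylor_jet_def
  proof (intro allI conjI)
    fix x y :: real
    show "0 \<le> F y - \<eta> / 2 * y\<^sup>2 - (F x - \<eta> / 2 * x\<^sup>2) - (deriv F x - \<eta> * x) * (y - x)"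
      using lower by simp
    have "(M - \<eta>) / 2 * (y - x)\<^sup>2 = M / 2 * y\<^sup>2 - M / 2 * x\<^sup>2 - M * x * (y - x)
        - (\<eta> / 2 * y\<^sup>2 - \<eta> / 2 * x\<^sup>2 - \<eta> * x * (y - x))"
      by (simp add: field_simps power2_eq_square)
    then show "F y - \<eta> / 2 * y\<^sup>2 - (F x - \<eta> / 2 * x\<^sup>2) - (deriv F x - \<eta> * x) * (y - x)
        \<le> (M - \<eta>) / 2 * (y - x)\<^sup>2"
      using upper[where x = x and y = y] by (simp add: left_diff_distrib)
  qed
qed

lemma taylor_jet_imp_strongly_convex:
  assumes J: "taylor_jet L G g" and L: "L > 0" and \<eta>: "\<eta> \<ge> 0"
  defines "F \<equiv> \<lambda>x. G x + \<eta> / 2 * x\<^sup>2"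
  shows "F \<in> C11c" "strongly_convex \<eta> F" "Lip (deriv F) \<le> ereal (L + \<eta>)"
proof -
  note dG = taylor_jet_has_derivative[OF J]
  have dF: "(F has_real_derivative g x + \<eta> * x) (at x)" for x
    unfolding F_def by (auto intro!: derivative_eq_intros dG)
  then have deriv: "deriv F = (\<lambda>x. g x + \<eta> * x)"
    by (auto intro: DERIV_imp_deriv)
  have "\<bar>deriv F x - deriv F y\<bar> \<le> (L + \<eta>) * \<bar>x - y\<bar>" for x y
  proof -
    have "deriv F x - deriv F y = (g x - g y) + \<eta> * (x - y)"
      by (simp add: deriv algebra_simps)
    then have "\<bar>deriv F x - deriv F y\<bar> \<le> \<bar>g x - g y\<bar> + \<eta> * \<bar>x - y\<bar>"
      using \<eta> abs_triangle_ineq[of "g x - g y" "\<eta> * (x - y)"] by (simp add: abs_mult)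
    then show ?thesis
      using taylor_jet_lipschitz[OF J L, of x y] by (simp add: algebra_simps)
  qed
  then have lip: "(L + \<eta>)-lipschitz_on UNIV (deriv F)"
    using L \<eta> by (auto simp: lipschitz_on_def dist_real_def)
  then show "Lip (deriv F) \<le> ereal (L + \<eta>)"
    using L \<eta> by (subst Lip_le_iff) auto
  have "convex_on UNIV F"
    by (rule convex_on_realI[where f' = "\<lambda>x. g x + \<eta> * x"])
       (use dF taylor_jet_slope(1)[OF J L] \<eta> in \<open>auto intro!: add_mono mult_left_mono\<close>)
  moreover have "F differentiable_on UNIV"
    using dF by (auto simp: differentiable_on_def real_differentiable_def)
  ultimately show "F \<in> C11c"
    using lip by (auto simp: C11c_def)
  have "convex_on UNIV G"
    by (rule convex_on_realI[where f' = g]) (use dG taylor_jet_slope(1)[OF J L] in auto)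
  then show "strongly_convex \<eta> F"
    by (simp add: strongly_convex_def F_def)
qed

theorem theorem2:
  fixes E :: "real set" and M \<eta> :: real and f :: "real \<Rightarrow> real"
  assumes "compact E" and "\<eta> \<ge> 0" and "M > \<eta>"
    and "\<And>S. S \<subseteq> E \<Longrightarrow> finite S \<Longrightarrow> card S \<le> 5 \<Longrightarrow>
           \<exists>F\<in>C11c. strongly_convex \<eta> F \<and> (\<forall>x\<in>S. F x = f x) \<and> Lip (deriv F) \<le> ereal M"
  shows "\<exists>F\<in>C11c. strongly_convex \<eta> F \<and> (\<forall>x\<in>E. F x = f x) \<and> Lip (deriv F) \<le> ereal (5 * M)"
proof -
  define f' where "f' x = f x - \<eta> / 2 * x\<^sup>2" for x
  define L where "L = 7 / 2 * (M - \<eta>)"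
  have "L > 0" using assms by (simp add: L_def)
  have five: "\<exists>F g. taylor_jet (M - \<eta>) F g \<and> (\<forall>x\<in>T. F x = f' x)"
    if "T \<subseteq> E" "finite T" "card T \<le> 5" for T
  proof -
    obtain F where F: "F \<in> C11c" "strongly_convex \<eta> F" "\<forall>x\<in>T. F x = f x" "Lip (deriv F) \<le> ereal M"
      using assms(4)[OF \<open>T \<subseteq> E\<close> \<open>finite T\<close> \<open>card T \<le> 5\<close>] by blast
    have "M \<ge> 0" using assms by simp
    then show ?thesis
      using strongly_convex_imp_taylor_jet[OF F(1,2,4)] F(3)
      by (intro exI[of _ "\<lambda>x. F x - \<eta> / 2 * x\<^sup>2"] exI[of _ "\<lambda>x. deriv F x - \<eta> * x"]) (simp add: f'_def)
  qed
  have "\<exists>F g. taylor_jet L F g \<and> (\<forall>x\<in>S. F x = f' x)" if "S \<subseteq> E" "finite S" for S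
    unfolding L_def
  proof (rule finite_set_interpolation)
    show "\<exists>F g. taylor_jet (M - \<eta>) F g \<and> (\<forall>x\<in>T. F x = f' x)" if "T \<subseteq> S" "card T \<le> 5" for T
      using five[of T] that \<open>S \<subseteq> E\<close> finite_subset[OF \<open>T \<subseteq> S\<close> \<open>finite S\<close>] by blast
  qed (use assms that in auto)
  then obtain G g where G: "taylor_jet L G g" "\<forall>x\<in>E. G x = f' x"
    using interpolation_by_compactness[OF \<open>L > 0\<close>, of E f'] by blast
  let ?F = "\<lambda>x. G x + \<eta> / 2 * x\<^sup>2"
  note F = taylor_jet_imp_strongly_convex[OF G(1) \<open>L > 0\<close> \<open>\<eta> \<ge> 0\<close>]
  have "L + \<eta> \<le> 5 * M"
    using assms(2,3) by (simp add: L_def field_simps)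
  then have "ereal (L + \<eta>) \<le> ereal (5 * M)" by simp
  with F(3) have "Lip (deriv ?F) \<le> ereal (5 * M)"
    by (rule order_trans)
  moreover have "\<forall>x\<in>E. ?F x = f x"
    using G(2) by (simp add: f'_def)
  ultimately show ?thesis
    using F(1,2) by (intro bexI[of _ ?F]) auto
qed

end
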